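(* Let $n\ge 1$ be an integer. Let $\mathcal{N}^{\mathrm{unif}}_{n}$ be the set of all functions $K:[0,1]^n\to\mathbb{R}$ realized by P1-ICKAN networks with (non-adapted) uniform grids, where the number $P\ge1$ of mesh intervals, the depth $L\ge 1$, the widths $n_0,\dots,n_{L-1}\ge 1$ and all trainable parameters are allowed to vary. Then $\mathcal{N}^{\mathrm{unif}}_{n}$ is dense, with respect to the sup norm, in the set of Lipschitz convex functions on $[0,1]^n$; that is, for every Lipschitz convex function $f:[0,1]^n\to\mathbb{R}$ and every $\epsilon>0$ there exists $K\in\mathcal{N}^{\mathrm{unif}}_{n}$ such that $\sup_{x\in[0,1]^n}|f(x)-K(x)|<\epsilon$.
   Context: **One-dimensional building block.** Let $P\ge1$ be an integer, $\underline g\le\bar g$ reals, and $\underline g=\hat x_0\le\hat x_1\le\dots\le\hat x_P=\bar g$ a grid of $[\underline g,\bar g]$ (strictly increasing if $\underline g<\bar g$). Given real parameters $b,\ c,\ d_1,\dots,d_{P-1}$, define nodal values $$a_p=b+\sum_{s=1}^{p}\Bigl(c+\sum_{i=1}^{s-1}\max(d_i,0)\Bigr)(\hat x_s-\hat x_{s-1}),\qquad p=0,\dots,P,$$ and let $\phi:[\underline g,\bar g]\to\mathbb{R}$ be the continuous function that is affine on each $[\hat x_{p-1},\hat x_p]$ with $\phi(\hat x_p)=a_p$ (if $\underline g=\bar g$, $\phi$ is the constant $b$). Equivalently $\phi=\sum_{p=0}^P a_p\Psi_p$ with $\Psi_p$ the P1 hat functions of the grid. **Grids (non-adapted version).** The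 grid of an interval $[\underline g,\bar g]$ is uniform: $\hat x_p=\underline g+\frac{p}{P}(\bar g-\underline g)$, $p=0,\dots,P$. **Layers.** Fix a number of mesh intervals $P\ge1$ (the same for the whole network), a depth $L\ge1$ and widths $n_0,\dots,n_{L-1}\ge1$; set $n_{-1}=n$ and $n_L=1$. Put $G^0=[0,1]^n$. For $l=0,\dots,L$, layer $l$ has as input domain a hyperrectangle $G^l=\prod_{j=1}^{n_{l-1}}[\underline G^l_j,\bar G^l_j]$. For each input coordinate $j$, let $(\hat x_{l,j,p})_{p=0,\dots,P}$ be the uniform grid of $[\underline G^l_j,\bar G^l_j]$. For $k=1,\dots,n_l$ and $j=1,\dots,n_{l-1}$ choose trainable reals $b_{l,k,j},\hat b_{l,k,j},d_{l,k,j,1},\dots,d_{l,k,j,P-1}$, and let $\phi_{l,k,j}$ be the building block on this grid with $b=b_{l,k,j}$, $d_i=d_{l,k,j,i}$, and $$c=\hat b_{0,k,j}\ \text{ if } l=0,\qquad c=\max(\hat b_{l,k,j},0)\ \text{ if } l\ge1.$$ Let $a_{l,k,j,p}=\phi_{l,k,j}(\hat x_{l,j,p})$ be its nodal values. The layer map is $$\hat\kappa^l(x)_k=\sum_{j=1}^{n_{l-1}}\phi_{l,k,j}(x_j),\qquad x\in G^l,\ k=1,\dots,n_l,$$ and the input domain of the next layer is $G^{l+1}=\prod_{k=1}^{n_l}[\underline G^{l+1}_k,\bar G^{l+1}_k]$ with $$\underline G^{l+1}_k=\sum_{j=1}^{n_{l-1}}\min_{0\le p\le P}a_{l,k,j,p},\qquad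 \bar G^{l+1}_k=\sum_{j=1}^{n_{l-1}}\max(a_{l,k,j,0},a_{l,k,j,P}).$$ One has $\hat\kappa^l(G^l)\subset G^{l+1}$, so the layers can be composed. **Network.** The P1-ICKAN function with these parameters is $K=\hat\kappa^L\circ\hat\kappa^{L-1}\circ\dots\circ\hat\kappa^0:[0,1]^n\to\mathbb{R}$. All $b_{l,k,j},\hat b_{l,k,j},d_{l,k,j,i}\in\mathbb{R}$ are free. *)

theory Defs
  imports "HOL-Analysis.Analysis"
begin

section \<open>One-dimensional building block\<close>

text \<open>A grid is a function \<open>xh\<close> of which only \<open>xh 0, \<dots>, xh P\<close> matter.\<close>

definition p1_nodal :: "real \<Rightarrow> real \<Rightarrow> (nat \<Rightarrow> real) \<Rightarrow> (nat \<Rightarrow> real) \<Rightarrow> nat \<Rightarrow> real" where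
  "p1_nodal b c d xh p =
     b + (\<Sum>s=1..p. (c + (\<Sum>i=1..s-1. max (d i) 0)) * (xh s - xh (s - 1)))"

text \<open>Continuous piecewise affine interpolation of the values \<open>a p\<close> at the nodes \<open>xh p\<close>:
  \<open>x\<close> lies in the cell \<open>[xh (p - 1), xh p]\<close> for the least \<open>p \<ge> 1\<close> with \<open>x \<le> xh p\<close>.
  When all nodes coincide, division by zero makes this the constant \<open>a 0\<close>
  on the one-point domain. Values outside the interval of the grid are irrelevant.\<close>

definition p1_interp :: "(nat \<Rightarrow> real) \<Rightarrow> (nat \<Rightarrow> real) \<Rightarrow> real \<Rightarrow> real" where
  "p1_interp xh a x =
     (let p = (LEAST p. 1 \<le> p \<and> x \<le> xh p)
      in a (p - 1) + (a p - a (p - 1)) * ((x - xh (p - 1)) / (xh p - xh (p - 1))))"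

lemma p1_interp_on_cell:
  assumes grid: "\<And>q. 1 \<le> q \<Longrightarrow> q \<le> P \<Longrightarrow> xh (q - 1) < xh q"
    and p: "1 \<le> p" "p \<le> P" and x: "xh (p - 1) \<le> x" "x \<le> xh p"
  shows "p1_interp xh a x =
           a (p - 1) + (a p - a (p - 1)) * ((x - xh (p - 1)) / (xh p - xh (p - 1)))"
proof -
  have mono: "xh i < xh j" if "i < j" "j \<le> P" for i j
    using that
  proof (induction j)
    case (Suc j)
    then show ?case using grid[of "Suc j"] by (cases "i = j") force+
  qed simp
  have low: "xh q < x" if "1 \<le> q" "q < p - 1" for q
    using mono[OF that(2)] p x by linarith
  show ?thesis
  proof (cases "1 < p \<and> x = xh (p - 1)")
    case True
    have "(LEAST q. 1 \<le> q \<and> x \<le> xh q) = p - 1"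
      using True low by (intro Least_equality) (auto simp: not_less[symmetric])
    moreover have "xh (p - 1 - 1) < xh (p - 1)"
      using True p by (intro grid) linarith+
    ultimately show ?thesis using True by (simp add: p1_interp_def)
  next
    case False
    have "xh q < x" if "1 \<le> q" "q < p" for q
      using that low[of q] x False by (cases "q = p - 1") auto
    then have "(LEAST q. 1 \<le> q \<and> x \<le> xh q) = p"
      using p x by (intro Least_equality) (auto simp: not_less[symmetric])
    then show ?thesis by (simp add: p1_interp_def)
  qed
qed

lemma p1_interp_degenerate:
  assumes "\<And>p. xh p = g"
  shows "p1_interp xh (p1_nodal b c d xh) g = b"
  using assms by (simp add: p1_interp_def p1_nodal_def)

definition uniform_grid :: "nat \<Rightarrow> real \<times> real \<Rightarrow> nat \<Rightarrow> real" where
  "uniform_grid P I p = fst I + real p / real P * (snd I - fst I)"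


section \<open>P1-ICKAN networks on uniform grids\<close>

text \<open>Coordinates, neurons and layers are indexed as in the mathematical notation: \<open>width N l\<close>
  is $n_l$ for \<open>l = 0, \<dots>, L\<close>, and in \<open>par_b N l k j\<close>, \<open>par_bh N l k j\<close> and \<open>par_d N l k j i\<close>
  the indices \<open>k\<close>, \<open>j\<close>, \<open>i\<close> start from 1. Parameters outside these ranges are never used.\<close>

record ickan =
  mesh :: nat
  depth :: nat
  width :: "nat \<Rightarrow> nat"
  par_b :: "nat \<Rightarrow> nat \<Rightarrow> nat \<Rightarrow> real"
  par_bh :: "nat \<Rightarrow> nat \<Rightarrow> nat \<Rightarrow> real"
  par_d :: "nat \<Rightarrow> nat \<Rightarrow> nat \<Rightarrow> nat \<Rightarrow> real"

definition wf_ickan :: "ickan \<Rightarrow> bool" where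
  "wf_ickan N \<longleftrightarrow> 1 \<le> mesh N \<and> 1 \<le> depth N \<and>
     (\<forall>l<depth N. 1 \<le> width N l) \<and> width N (depth N) = 1"

text \<open>The number of inputs of layer \<open>l\<close>, that is $n_{l-1}$ with $n_{-1} = n$.\<close>

definition in_width :: "nat \<Rightarrow> ickan \<Rightarrow> nat \<Rightarrow> nat" where
  "in_width n N l = (case l of 0 \<Rightarrow> n | Suc m \<Rightarrow> width N m)"

text \<open>Nodal values of the block \<open>(l, k, j)\<close> when its input interval is \<open>I\<close>.\<close>

definition block_nodal :: "ickan \<Rightarrow> nat \<Rightarrow> nat \<Rightarrow> nat \<Rightarrow> real \<times> real \<Rightarrow> nat \<Rightarrow> real" where
  "block_nodal N l k j I =
     p1_nodal (par_b N l k j) (if l = 0 then par_bh N l k j else max (par_bh N l k j) 0)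
       (par_d N l k j) (uniform_grid (mesh N) I)"

text \<open>\<open>in_box n N l j\<close> is the pair of end points of the \<open>j\<close>-th side of the input domain $G^l$.\<close>

primrec in_box :: "nat \<Rightarrow> ickan \<Rightarrow> nat \<Rightarrow> nat \<Rightarrow> real \<times> real" where
  "in_box n N 0 = (\<lambda>j. (0, 1))"
| "in_box n N (Suc l) = (\<lambda>k.
     (\<Sum>j=1..in_width n N l. Min (block_nodal N l k j (in_box n N l j) ` {0..mesh N}),
      \<Sum>j=1..in_width n N l. max (block_nodal N l k j (in_box n N l j) 0)
                                 (block_nodal N l k j (in_box n N l j) (mesh N))))"

definition block :: "nat \<Rightarrow> ickan \<Rightarrow> nat \<Rightarrow> nat \<Rightarrow> nat \<Rightarrow> real \<Rightarrow> real" where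
  "block n N l k j =
     p1_interp (uniform_grid (mesh N) (in_box n N l j)) (block_nodal N l k j (in_box n N l j))"

definition layer :: "nat \<Rightarrow> ickan \<Rightarrow> nat \<Rightarrow> (nat \<Rightarrow> real) \<Rightarrow> nat \<Rightarrow> real" where
  "layer n N l x k = (\<Sum>j=1..in_width n N l. block n N l k j (x j))"

primrec compose_layers :: "nat \<Rightarrow> ickan \<Rightarrow> nat \<Rightarrow> (nat \<Rightarrow> real) \<Rightarrow> nat \<Rightarrow> real" where
  "compose_layers n N 0 x = layer n N 0 x"
| "compose_layers n N (Suc l) x = layer n N (Suc l) (compose_layers n N l x)"

definition ickan_fun :: "nat \<Rightarrow> ickan \<Rightarrow> (nat \<Rightarrow> real) \<Rightarrow> real" where
  "ickan_fun n N x = compose_layers n N (depth N) x 1"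

text \<open>The set of realized functions on the unit cube \<open>cbox 0 1\<close> of \<open>real ^ 'n\<close>, as extensional
  functions. The enumeration \<open>e\<close> of the index type, meant to be a bijection from
  \<open>{1..CARD('n)}\<close> to \<open>UNIV\<close>, fixes the order of the coordinates.\<close>

definition ickan_unif :: "(nat \<Rightarrow> 'n) \<Rightarrow> (real ^ 'n::finite \<Rightarrow> real) set" where
  "ickan_unif e =
     {restrict (\<lambda>x. ickan_fun CARD('n) N (\<lambda>j. x $ e j)) (cbox 0 1) | N. wf_ickan N}"

end

theory Submission
  imports Defs
begin

text \<open>Separating points below the graph from the closed convex epigraph, and compactness, give a
  finite maximum of affine functions within any tolerance of \<open>f\<close>. This maximum is computed
  exactly by a network whose blocks are affine in layer 0 and otherwise one of $t$, $\max(t, 0)$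
  and $0$, all realizable by P1 blocks up to interpolation error. As these functions are monotone,
  the domains of the layers depend only on the end points of the grids and not on \<open>P\<close>; with
  depth and boxes fixed, Lipschitz continuity makes the total error $O(1/P)$.\<close>

section \<open>Affine minorants of convex functions\<close>

text \<open>Continuity on a closed set makes the epigraph closed. A hyperplane separating it
  strictly from \<open>(y, f y - \<epsilon>)\<close> is the graph of the required affine function,
  once it is known not to be vertical.\<close>

lemma convex_on_affine_minorant:
  fixes f :: "'a::euclidean_space \<Rightarrow> real"
  assumes "closed S" and cvx: "convex_on S f" and cont: "continuous_on S f"
    and y: "y \<in> S" and \<epsilon>: "\<epsilon> > 0"
  obtains a c where "\<And>x. x \<in> S \<Longrightarrow> a \<bullet> x + c \<le> f x" and "f y - \<epsilon> < a \<bullet> y + c"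
proof -
  have "continuous_on (S \<times> UNIV) (\<lambda>p. f (fst p))"
    by (intro continuous_on_compose2[OF cont] continuous_intros) auto
  then have "closed {p \<in> S \<times> UNIV. f (fst p) \<le> snd p}"
    using \<open>closed S\<close> by (intro continuous_on_closed_Collect_le continuous_intros closed_Times) auto
  then have "closed (epigraph S f)"
    by (simp add: epigraph_def mem_Times_iff)
  moreover have "(y, f y - \<epsilon>) \<notin> epigraph S f"
    using \<epsilon> by (simp add: mem_epigraph)
  ultimately obtain u b where u: "u \<bullet> (y, f y - \<epsilon>) < b" "\<forall>p\<in>epigraph S f. b < u \<bullet> p"
    using separating_hyperplane_closed_point[of "epigraph S f"] convex_epigraphI[OF cvx] by blast
  obtain v s where [simp]: "u = (v, s)"
    by (cases u)
  have above: "b < v \<bullet> x + s * f x" if "x \<in> S" for x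
    using bspec[OF u(2), of "(x, f x)"] that by (simp add: mem_epigraph inner_Pair)
  have below: "v \<bullet> y + s * f y - s * \<epsilon> < b"
    using u(1) by (simp add: inner_Pair algebra_simps)
  \<comment> \<open>Both estimates concern the same point \<open>y\<close>, so the part in
    \<open>v\<close> cancels; this excludes a vertical hyperplane.\<close>
  have "s * \<epsilon> > 0"
    using above[OF y] below by linarith
  then have s: "s > 0"
    using \<epsilon> by (simp add: zero_less_mult_iff)
  show ?thesis
  proof (rule that)
    show "(- (1 / s) *\<^sub>R v) \<bullet> x + b / s \<le> f x" if "x \<in> S" for x
      using above[OF that] s by (simp add: field_simps)
    show "f y - \<epsilon> < (- (1 / s) *\<^sub>R v) \<bullet> y + b / s"
      using below s by (simp add: field_simps)
  qed
qed

text \<open>Each affine minorant is \<epsilon>-close to \<open>f\<close> on a relatively open set.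
  The preceding lemma shows that these sets cover \<open>S\<close>, and a finite subcover gives
  \<open>T\<close>.\<close>

lemma convex_on_approx_finite_affine:
  fixes f :: "'a::euclidean_space \<Rightarrow> real"
  assumes "compact S" and cvx: "convex_on S f" and cont: "continuous_on S f" and \<epsilon>: "\<epsilon> > 0"
  obtains T where "finite T" and "\<And>a c x. (a, c) \<in> T \<Longrightarrow> x \<in> S \<Longrightarrow> a \<bullet> x + c \<le> f x"
    and "\<And>x. x \<in> S \<Longrightarrow> \<exists>(a, c)\<in>T. f x - \<epsilon> < a \<bullet> x + c"
proof -
  define M where "M = {(a, c). \<forall>x\<in>S. a \<bullet> x + c \<le> f x}"
  define U where "U = (\<lambda>(a, c). {x \<in> S. f x - (a \<bullet> x + c) < \<epsilon>})"
  have "openin (top_of_set S) (U p)" for p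
  proof -
    have "continuous_on S (\<lambda>x. f x - (fst p \<bullet> x + snd p))"
      by (intro continuous_intros cont)
    from continuous_openin_preimage_gen[OF this, of "{..<\<epsilon>}"] show ?thesis
      by (simp add: U_def case_prod_unfold vimage_def Int_def)
  qed
  moreover have "S \<subseteq> \<Union> (U ` M)"
  proof
    fix y assume y: "y \<in> S"
    obtain a c where "\<And>x. x \<in> S \<Longrightarrow> a \<bullet> x + c \<le> f x" "f y - \<epsilon> < a \<bullet> y + c"
      using convex_on_affine_minorant[OF compact_imp_closed[OF \<open>compact S\<close>] cvx cont y \<epsilon>] by blast
    then show "y \<in> \<Union> (U ` M)"
      using y by (intro UN_I[of "(a, c)"]) (auto simp: M_def U_def)
  qed
  ultimately obtain D where D: "D \<subseteq> U ` M" "finite D" "S \<subseteq> \<Union> D"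
    using \<open>compact S\<close>[unfolded compact_eq_openin_cover] by (metis (no_types, lifting) imageE)
  then obtain T where T: "T \<subseteq> M" "finite T" "D = U ` T"
    by (meson finite_subset_image)
  show ?thesis
  proof (rule that[of T])
    show "\<exists>(a, c)\<in>T. f x - \<epsilon> < a \<bullet> x + c" if "x \<in> S" for x
      using that D(3) T(3) by (fastforce simp: U_def)
  qed (use T in \<open>auto simp: M_def\<close>)
qed


section \<open>Interpolation of convex functions by building blocks\<close>

text \<open>The slope over cell \<open>i\<close> of a grid with step \<open>h\<close> starting at
  \<open>x\<close>. For \<open>h = 0\<close> division by zero gives 0, which suits an interval
  reduced to a point.\<close>

definition secant :: "(real \<Rightarrow> real) \<Rightarrow> real \<Rightarrow> real \<Rightarrow> nat \<Rightarrow> real" where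
  "secant \<psi> x h i = (\<psi> (x + real (Suc i) * h) - \<psi> (x + real i * h)) / h"

text \<open>This is midpoint convexity at the middle one of three consecutive nodes.\<close>

lemma secant_mono:
  assumes "convex_on UNIV \<psi>" "h \<ge> 0"
  shows "secant \<psi> x h i \<le> secant \<psi> x h (Suc i)"
proof -
  have "\<psi> ((1/2) *\<^sub>R (x + real i * h) + (1/2) *\<^sub>R (x + real (Suc (Suc i)) * h)) \<le>
        (1/2) * \<psi> (x + real i * h) + (1/2) * \<psi> (x + real (Suc (Suc i)) * h)"
    using assms(1) unfolding convex_on_def by (metis UNIV_I field_sum_of_halves half_gt_zero_iff less_eq_real_def zero_less_one)
  moreover have "(1/2) *\<^sub>R (x + real i * h) + (1/2) *\<^sub>R (x + real (Suc (Suc i)) * h) = x + real (Suc i) * h"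
    by (simp add: field_simps)
  ultimately have "\<psi> (x + real (Suc i) * h) \<le>
      (1/2) * \<psi> (x + real i * h) + (1/2) * \<psi> (x + real (Suc (Suc i)) * h)"
    by simp
  then show ?thesis
    unfolding secant_def using assms(2) by (intro divide_right_mono) auto
qed

text \<open>Convexity makes the slope increments nonnegative, so clipping them at 0 changes nothing,
  and the sums telescope first to slopes and then to values.\<close>

lemma p1_nodal_secant:
  assumes "convex_on UNIV \<psi>" "h \<ge> 0" and grid: "\<And>p. xh p = x + real p * h"
  shows "p1_nodal (\<psi> x) (secant \<psi> x h 0) (\<lambda>i. secant \<psi> x h i - secant \<psi> x h (i - 1)) xh p
    = \<psi> (xh p)"
proof -
  have slope: "secant \<psi> x h 0 + (\<Sum>i=1..p. max (secant \<psi> x h i - secant \<psi> x h (i - 1)) 0)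
      = secant \<psi> x h p" for p
  proof (induction p)
    case (Suc p)
    then show ?case
      using secant_mono[OF assms(1,2), of x p] by simp
  qed simp
  show ?thesis
  proof (induction p)
    case (Suc p)
    have "secant \<psi> x h p * (xh (Suc p) - xh p) = \<psi> (xh (Suc p)) - \<psi> (xh p)"
      by (cases "h = 0") (simp_all add: secant_def grid distrib_right)
    then show ?case
      using Suc slope[of p] by (simp add: p1_nodal_def)
  qed (simp add: p1_nodal_def grid)
qed

section \<open>Interpolation on uniform grids: range and error\<close>

lemma uniform_grid_eq: "uniform_grid P (a, b) p = a + real p * ((b - a) / real P)"
  by (simp add: uniform_grid_def)

lemma uniform_grid_in_interval:
  assumes "a \<le> b" "p \<le> P"
  shows "uniform_grid P (a, b) p \<in> {a..b}"
proof -
  have "real p / real P \<in> {0..1}"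
    using assms(2) by (auto simp: divide_le_eq_1)
  then have "0 \<le> real p / real P * (b - a)" "real p / real P * (b - a) \<le> b - a"
    using assms(1) by (auto intro!: mult_left_le_one_le simp del: times_divide_eq_left)
  then show ?thesis
    by (simp add: uniform_grid_def)
qed

text \<open>Range and error bounds both come from writing the interpolant as a convex combination of
  two nearby nodal values. The case \<open>a = b\<close> is included: division by zero then gives
  \<open>t = 0\<close>.\<close>

lemma p1_interp_uniform_grid_cell:
  assumes ab: "a \<le> b" and P: "1 \<le> P" and x: "x \<in> {a..b}"
  obtains p t where "1 \<le> p" "p \<le> P" "t \<in> {0..1}"
    "\<And>v. p1_interp (uniform_grid P (a, b)) v x = (1 - t) * v (p - 1) + t * v p"
    "\<bar>uniform_grid P (a, b) (p - 1) - x\<bar> \<le> (b - a) / real P"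
    "\<bar>uniform_grid P (a, b) p - x\<bar> \<le> (b - a) / real P"
proof -
  let ?X = "uniform_grid P (a, b)"
  define p where "p = (LEAST p. 1 \<le> p \<and> x \<le> ?X p)"
  have last: "1 \<le> P \<and> x \<le> ?X P"
    using P x by (simp add: uniform_grid_eq)
  have p: "1 \<le> p" "x \<le> ?X p"
    using LeastI[of "\<lambda>p. 1 \<le> p \<and> x \<le> ?X p", OF last] by (auto simp: p_def)
  have "p \<le> P"
    unfolding p_def by (rule Least_le) (rule last)
  have lower: "?X (p - 1) \<le> x"
  proof (cases "p = 1")
    case True
    then show ?thesis using x by (simp add: uniform_grid_eq)
  next
    case False
    then have "\<not> (1 \<le> p - 1 \<and> x \<le> ?X (p - 1))"
      using p not_less_Least[of "p - 1" "\<lambda>p. 1 \<le> p \<and> x \<le> ?X p"] by (simp add: p_def)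
    then show ?thesis using False p by auto
  qed
  have step: "?X p - ?X (p - 1) = (b - a) / real P"
    using p(1) by (simp add: uniform_grid_eq of_nat_diff left_diff_distrib diff_divide_distrib)
  define t where "t = (x - ?X (p - 1)) / (?X p - ?X (p - 1))"
  have "t \<in> {0..1}"
    using lower p(2) by (auto simp: t_def divide_le_eq_1)
  moreover have "p1_interp ?X v x = (1 - t) * v (p - 1) + t * v p" for v
    unfolding p1_interp_def p_def[symmetric] Let_def t_def[symmetric] by (simp add: algebra_simps)
  ultimately show ?thesis
    using p lower step \<open>p \<le> P\<close> by (intro that[of p t]) auto
qed

lemma monotone_bounds:
  fixes \<psi> :: "real \<Rightarrow> real"
  assumes "mono \<psi> \<or> antimono \<psi>" "x \<in> {a..b}"
  shows "\<psi> x \<in> {min (\<psi> a) (\<psi> b)..max (\<psi> a) (\<psi> b)}"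
  using assms by (auto simp: min_le_iff_disj le_max_iff_disj dest: monoD antimonoD)

lemma p1_interp_in_range:
  assumes "mono \<psi> \<or> antimono \<psi>" "a \<le> b" "1 \<le> P" "x \<in> {a..b}"
    and v: "\<And>p. v p = \<psi> (uniform_grid P (a, b) p)"
  shows "p1_interp (uniform_grid P (a, b)) v x \<in> {min (\<psi> a) (\<psi> b)..max (\<psi> a) (\<psi> b)}"
proof -
  obtain p t where p: "1 \<le> p" "p \<le> P" "t \<in> {0..1}"
    and eq: "\<And>v. p1_interp (uniform_grid P (a, b)) v x = (1 - t) * v (p - 1) + t * v p"
    using p1_interp_uniform_grid_cell[OF assms(2-4)] by metis
  let ?I = "{min (\<psi> a) (\<psi> b)..max (\<psi> a) (\<psi> b)}"
  have "v (p - 1) \<in> ?I" "v p \<in> ?I"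
    unfolding v using p assms(2) by (intro monotone_bounds[OF assms(1)] uniform_grid_in_interval; simp)+
  then have "(1 - t) *\<^sub>R v (p - 1) + t *\<^sub>R v p \<in> ?I"
    using p(3) by (intro convexD) auto
  then show ?thesis by (simp add: eq)
qed

text \<open>Both nodal values lie in the ball of radius \<open>C\<close> times the mesh width around
  \<open>\<psi> x\<close>, and balls are convex.\<close>

lemma p1_interp_error:
  assumes lip: "C-lipschitz_on UNIV \<psi>" and "a \<le> b" "1 \<le> P" "x \<in> {a..b}"
    and v: "\<And>p. v p = \<psi> (uniform_grid P (a, b) p)"
  shows "\<bar>p1_interp (uniform_grid P (a, b)) v x - \<psi> x\<bar> \<le> C * ((b - a) / real P)"
proof -
  let ?X = "uniform_grid P (a, b)" and ?h = "(b - a) / real P"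
  obtain p t where p: "t \<in> {0..1}"
    and eq: "\<And>v. p1_interp ?X v x = (1 - t) * v (p - 1) + t * v p"
    and near: "\<bar>?X (p - 1) - x\<bar> \<le> ?h" "\<bar>?X p - x\<bar> \<le> ?h"
    using p1_interp_uniform_grid_cell[OF assms(2-4)] by metis
  have close: "v q \<in> cball (\<psi> x) (C * ?h)" if "\<bar>?X q - x\<bar> \<le> ?h" for q
    using lipschitz_onD[OF lip, of x "?X q"] mult_left_mono[OF that lipschitz_on_nonneg[OF lip]]
    by (simp add: v dist_real_def abs_minus_commute)
  have "(1 - t) *\<^sub>R v (p - 1) + t *\<^sub>R v p \<in> cball (\<psi> x) (C * ?h)"
    using p near by (intro convexD convex_cball close) auto
  then show ?thesis by (simp add: eq dist_real_def abs_minus_commute)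
qed


section \<open>Networks with convex monotone activations\<close>

text \<open>A network with general functions \<open>\<psi> l k j\<close> in place of the building blocks, and the
  boxes it would propagate. These boxes do not involve a mesh, so the parameters of an
  approximating P1-ICKAN can be written down without reference to its own input domains.\<close>

primrec kan_fun :: "(nat \<Rightarrow> nat) \<Rightarrow> (nat \<Rightarrow> nat \<Rightarrow> nat \<Rightarrow> real \<Rightarrow> real) \<Rightarrow> nat \<Rightarrow>
    (nat \<Rightarrow> real) \<Rightarrow> nat \<Rightarrow> real" where
  "kan_fun m \<psi> 0 x k = (\<Sum>j=1..m 0. \<psi> 0 k j (x j))"
| "kan_fun m \<psi> (Suc l) x k = (\<Sum>j=1..m (Suc l). \<psi> (Suc l) k j (kan_fun m \<psi> l x j))"

primrec kan_box :: "(nat \<Rightarrow> nat) \<Rightarrow> (nat \<Rightarrow> nat \<Rightarrow> nat \<Rightarrow> real \<Rightarrow> real) \<Rightarrow> nat \<Rightarrow> nat \<Rightarrow> real \<times> real" where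
  "kan_box m \<psi> 0 = (\<lambda>j. (0, 1))"
| "kan_box m \<psi> (Suc l) = (\<lambda>k.
     (\<Sum>j=1..m l. min (\<psi> l k j (fst (kan_box m \<psi> l j))) (\<psi> l k j (snd (kan_box m \<psi> l j))),
      \<Sum>j=1..m l. max (\<psi> l k j (fst (kan_box m \<psi> l j))) (\<psi> l k j (snd (kan_box m \<psi> l j)))))"

definition kan_step :: "(nat \<Rightarrow> nat) \<Rightarrow> (nat \<Rightarrow> nat \<Rightarrow> nat \<Rightarrow> real \<Rightarrow> real) \<Rightarrow> nat \<Rightarrow> nat \<Rightarrow> nat \<Rightarrow> real" where
  "kan_step m \<psi> P l j = (snd (kan_box m \<psi> l j) - fst (kan_box m \<psi> l j)) / real P"

text \<open>The parameters are those of \<open>p1_nodal_secant\<close> on the boxes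
  \<open>kan_box\<close>. As \<open>m l\<close> counts the inputs of layer \<open>l\<close>, the
  widths are shifted by one.\<close>

definition kan_ickan :: "(nat \<Rightarrow> nat) \<Rightarrow> (nat \<Rightarrow> nat \<Rightarrow> nat \<Rightarrow> real \<Rightarrow> real) \<Rightarrow> nat \<Rightarrow> nat \<Rightarrow> ickan" where
  "kan_ickan m \<psi> L P =
     \<lparr>mesh = P, depth = L, width = (\<lambda>l. m (Suc l)),
      par_b = (\<lambda>l k j. \<psi> l k j (fst (kan_box m \<psi> l j))),
      par_bh = (\<lambda>l k j. secant (\<psi> l k j) (fst (kan_box m \<psi> l j)) (kan_step m \<psi> P l j) 0),
      par_d = (\<lambda>l k j i. secant (\<psi> l k j) (fst (kan_box m \<psi> l j)) (kan_step m \<psi> P l j) i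
                 - secant (\<psi> l k j) (fst (kan_box m \<psi> l j)) (kan_step m \<psi> P l j) (i - 1))\<rparr>"

lemma kan_ickan_sel [simp]:
  "mesh (kan_ickan m \<psi> L P) = P" "depth (kan_ickan m \<psi> L P) = L"
  "width (kan_ickan m \<psi> L P) l = m (Suc l)"
  by (simp_all add: kan_ickan_def)

lemma in_width_kan_ickan [simp]: "in_width (m 0) (kan_ickan m \<psi> L P) l = m l"
  by (cases l) (simp_all add: in_width_def)

lemma kan_box_le: "fst (kan_box m \<psi> l j) \<le> snd (kan_box m \<psi> l j)"
  by (cases l) (auto intro!: sum_mono)

lemma abs_sum_diff_le:
  fixes g h :: "nat \<Rightarrow> real"
  assumes "\<And>j. j \<in> J \<Longrightarrow> \<bar>g j - h j\<bar> \<le> D j / r"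
  shows "\<bar>sum g J - sum h J\<bar> \<le> sum D J / r"
proof -
  have "\<bar>sum g J - sum h J\<bar> \<le> (\<Sum>j\<in>J. \<bar>g j - h j\<bar>)"
    by (simp add: sum_subtractf[symmetric])
  also have "\<dots> \<le> (\<Sum>j\<in>J. D j / r)"
    by (intro sum_mono assms)
  finally show ?thesis
    by (simp add: sum_divide_distrib)
qed

text \<open>Convexity neutralizes the clipping of the \<open>d\<close> parameters, and monotonicity
  after layer 0 that of the first slope. Monotonicity in either direction puts the extremes of a
  block at its end points. The Lipschitz constants control the error.\<close>

locale convex_kan =
  fixes m :: "nat \<Rightarrow> nat" and \<psi> :: "nat \<Rightarrow> nat \<Rightarrow> nat \<Rightarrow> real \<Rightarrow> real"
    and C :: "nat \<Rightarrow> nat \<Rightarrow> nat \<Rightarrow> real"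
  assumes convex: "\<And>l k j. convex_on UNIV (\<psi> l k j)"
    and lipschitz: "\<And>l k j. (C l k j)-lipschitz_on UNIV (\<psi> l k j)"
    and monotone_first: "\<And>k j. mono (\<psi> 0 k j) \<or> antimono (\<psi> 0 k j)"
    and mono: "\<And>l k j. l > 0 \<Longrightarrow> mono (\<psi> l k j)"
begin

section \<open>Exact nodal values and boxes of the approximating network\<close>

lemma monotone: "mono (\<psi> l k j) \<or> antimono (\<psi> l k j)"
  using monotone_first mono by (cases l) auto

lemma block_nodal_kan_ickan:
  "block_nodal (kan_ickan m \<psi> L P) l k j (kan_box m \<psi> l j) p
     = \<psi> l k j (uniform_grid P (kan_box m \<psi> l j) p)"
proof -
  obtain a b where ab: "kan_box m \<psi> l j = (a, b)"
    by force
  have "a \<le> b"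
    using kan_box_le[of m \<psi> l j] by (simp add: ab)
  then have h: "(b - a) / real P \<ge> 0"
    by simp
  \<comment> \<open>The first slope is clipped only for \<open>l > 0\<close>, where
    \<open>\<psi> l k j\<close> is nondecreasing.\<close>
  have "secant (\<psi> l k j) a ((b - a) / real P) 0 \<ge> 0" if "l > 0"
    unfolding secant_def using h \<open>a \<le> b\<close> by (intro divide_nonneg_nonneg) (simp_all add: monoD[OF mono[OF that]])
  then have slope: "(if l = 0 then secant (\<psi> l k j) a ((b - a) / real P) 0
      else max (secant (\<psi> l k j) a ((b - a) / real P) 0) 0)
      = secant (\<psi> l k j) a ((b - a) / real P) 0"
    by (simp add: max_absorb1)
  show ?thesis
    using p1_nodal_secant[OF convex h uniform_grid_eq, of l k j p]
    by (simp only: block_nodal_def kan_ickan_def kan_step_def ab ickan.simps fst_conv snd_conv slope)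
qed

text \<open>Nodal values are exact, and a monotone function attains its extremes over the grid at
  nodes 0 and \<open>P\<close>. Hence the boxes do not change with \<open>P\<close>.\<close>

lemma in_box_kan_ickan:
  assumes "1 \<le> P"
  shows "in_box (m 0) (kan_ickan m \<psi> L P) l = kan_box m \<psi> l"
proof (induction l)
  case (Suc l)
  have first: "uniform_grid P I 0 = fst I" and last: "uniform_grid P I P = snd I" for I
    using assms by (simp_all add: uniform_grid_def)
  have "Min ((\<lambda>p. \<psi> l k j (uniform_grid P (kan_box m \<psi> l j) p)) ` {0..P}) =
      min (\<psi> l k j (fst (kan_box m \<psi> l j))) (\<psi> l k j (snd (kan_box m \<psi> l j)))" for k j
  proof (rule Min_eqI)
    obtain a b where ab: "kan_box m \<psi> l j = (a, b)"
      by force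
    show "min (\<psi> l k j (fst (kan_box m \<psi> l j))) (\<psi> l k j (snd (kan_box m \<psi> l j))) \<le> y"
      if "y \<in> (\<lambda>p. \<psi> l k j (uniform_grid P (kan_box m \<psi> l j) p)) ` {0..P}" for y
      using that kan_box_le[of m \<psi> l j]
        monotone_bounds[OF monotone uniform_grid_in_interval, of a b _ P l k j]
      by (auto simp: ab)
    show "min (\<psi> l k j (fst (kan_box m \<psi> l j))) (\<psi> l k j (snd (kan_box m \<psi> l j)))
      \<in> (\<lambda>p. \<psi> l k j (uniform_grid P (kan_box m \<psi> l j) p)) ` {0..P}"
      using imageI[of 0 "{0..P}" "\<lambda>p. \<psi> l k j (uniform_grid P (kan_box m \<psi> l j) p)"]
        imageI[of P "{0..P}" "\<lambda>p. \<psi> l k j (uniform_grid P (kan_box m \<psi> l j) p)"]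
      by (simp add: first last min_def)
  qed simp
  then show ?case
    by (simp add: Suc block_nodal_kan_ickan first last image_def)
qed simp

section \<open>Ranges and errors propagated through the layers\<close>

lemma block_kan_ickan_in_range:
  assumes "1 \<le> P" "x \<in> {fst (kan_box m \<psi> l j)..snd (kan_box m \<psi> l j)}"
  shows "block (m 0) (kan_ickan m \<psi> L P) l k j x \<in>
    {min (\<psi> l k j (fst (kan_box m \<psi> l j))) (\<psi> l k j (snd (kan_box m \<psi> l j)))..
     max (\<psi> l k j (fst (kan_box m \<psi> l j))) (\<psi> l k j (snd (kan_box m \<psi> l j)))}"
proof -
  obtain a b where ab: "kan_box m \<psi> l j = (a, b)"
    by force
  show ?thesis
    using p1_interp_in_range[OF monotone[of l k j] _ assms(1), of a b x
        "block_nodal (kan_ickan m \<psi> L P) l k j (a, b)"]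
      block_nodal_kan_ickan[of L P l k j] kan_box_le[of m \<psi> l j] assms
    by (simp add: block_def in_box_kan_ickan ab)
qed

text \<open>The interpolation error of a block is controlled only on its grid interval, so the
  approximate inputs must stay in the boxes.\<close>

lemma compose_layers_kan_ickan_in_box:
  assumes "1 \<le> P" "\<And>j. 1 \<le> j \<Longrightarrow> j \<le> m 0 \<Longrightarrow> x j \<in> {0..1}"
  shows "compose_layers (m 0) (kan_ickan m \<psi> L P) l x k \<in>
    {fst (kan_box m \<psi> (Suc l) k)..snd (kan_box m \<psi> (Suc l) k)}"
proof (induction l arbitrary: k)
  case 0
  have "block (m 0) (kan_ickan m \<psi> L P) 0 k j (x j) \<in>
      {min (\<psi> 0 k j 0) (\<psi> 0 k j 1)..max (\<psi> 0 k j 0) (\<psi> 0 k j 1)}" if "j \<in> {1..m 0}" for j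
    using block_kan_ickan_in_range[of P "x j" 0 j L k] assms that by simp
  then show ?case
    by (auto simp: layer_def intro!: sum_mono)
next
  case (Suc l)
  show ?case
    using block_kan_ickan_in_range[OF assms(1) Suc, of L]
    by (auto simp: layer_def kan_box.simps(2)[of m \<psi> "Suc l"] simp del: kan_box.simps intro!: sum_mono)
qed

text \<open>Inserting \<open>\<psi> l k j x\<close> splits the error into interpolation error and
  incoming error amplified by the Lipschitz constant.\<close>

lemma block_kan_ickan_error:
  assumes "1 \<le> P" "x \<in> {fst (kan_box m \<psi> l j)..snd (kan_box m \<psi> l j)}" "\<bar>x - y\<bar> \<le> \<delta> / real P"
  shows "\<bar>block (m 0) (kan_ickan m \<psi> L P) l k j x - \<psi> l k j y\<bar>
    \<le> C l k j * (\<delta> + (snd (kan_box m \<psi> l j) - fst (kan_box m \<psi> l j))) / real P"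
proof -
  obtain a b where ab: "kan_box m \<psi> l j = (a, b)"
    by force
  have "\<bar>\<psi> l k j x - \<psi> l k j y\<bar> \<le> C l k j * (\<delta> / real P)"
    using lipschitz_onD[OF lipschitz[of l k j], of x y]
      mult_left_mono[OF assms(3) lipschitz_on_nonneg[OF lipschitz[of l k j]]]
    by (simp add: dist_real_def)
  moreover have "\<bar>block (m 0) (kan_ickan m \<psi> L P) l k j x - \<psi> l k j x\<bar> \<le> C l k j * ((b - a) / real P)"
    using p1_interp_error[OF lipschitz[of l k j] _ assms(1), of a b x
        "block_nodal (kan_ickan m \<psi> L P) l k j (a, b)"]
      block_nodal_kan_ickan[of L P l k j] kan_box_le[of m \<psi> l j] assms(1,2)
    by (simp add: block_def in_box_kan_ickan ab)
  ultimately show ?thesis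
    by (simp add: ab add_divide_distrib distrib_left)
qed

text \<open>Numerators of error bounds of the form \<open>err l k / P\<close>, free of
  \<open>P\<close> themselves. In layer 0 the inputs are exact and the box sides have length
  1.\<close>

primrec err :: "nat \<Rightarrow> nat \<Rightarrow> real" where
  "err 0 k = (\<Sum>j=1..m 0. C 0 k j)"
| "err (Suc l) k = (\<Sum>j=1..m (Suc l). C (Suc l) k j *
     (err l j + (snd (kan_box m \<psi> (Suc l) j) - fst (kan_box m \<psi> (Suc l) j))))"

lemma compose_layers_kan_ickan_error:
  assumes "1 \<le> P" "\<And>j. 1 \<le> j \<Longrightarrow> j \<le> m 0 \<Longrightarrow> x j \<in> {0..1}"
  shows "\<bar>compose_layers (m 0) (kan_ickan m \<psi> L P) l x k - kan_fun m \<psi> l x k\<bar> \<le> err l k / real P"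
proof (induction l arbitrary: k)
  case 0
  have "\<bar>block (m 0) (kan_ickan m \<psi> L P) 0 k j (x j) - \<psi> 0 k j (x j)\<bar> \<le> C 0 k j / real P"
    if "j \<in> {1..m 0}" for j
    using block_kan_ickan_error[of P "x j" 0 j "x j" 0 L k] assms that by simp
  then show ?case
    by (simp only: compose_layers.simps layer_def kan_fun.simps err.simps in_width_kan_ickan)
      (rule abs_sum_diff_le)
next
  case (Suc l)
  show ?case
    unfolding compose_layers.simps layer_def kan_fun.simps err.simps in_width_kan_ickan
    using compose_layers_kan_ickan_in_box[of P x L l] assms Suc
    by (intro abs_sum_diff_le block_kan_ickan_error) blast+
qed

theorem kan_fun_approx:
  assumes "1 \<le> L" "\<And>l. l < L \<Longrightarrow> 1 \<le> m (Suc l)" "m (Suc L) = 1" "\<epsilon> > 0"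
  obtains N where "wf_ickan N" and "\<And>x. (\<And>j. j \<in> {1..m 0} \<Longrightarrow> x j \<in> {0..1}) \<Longrightarrow>
    \<bar>ickan_fun (m 0) N x - kan_fun m \<psi> L x 1\<bar> \<le> \<epsilon>"
proof -
  \<comment> \<open>\<open>P\<close> can be chosen last because \<open>err\<close> does not depend
    on it; the maximum with 1 ensures \<open>1 \<le> P\<close>.\<close>
  obtain P :: nat where P: "real P > max 1 (err L 1 / \<epsilon>)"
    using reals_Archimedean2 by blast
  then have P: "err L 1 / real P \<le> \<epsilon>" "1 \<le> P"
    using \<open>\<epsilon> > 0\<close> by (auto simp: field_simps)
  show ?thesis
  proof (rule that)
    show "wf_ickan (kan_ickan m \<psi> L P)"
      using assms(1-3) P by (simp add: wf_ickan_def)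
    show "\<bar>ickan_fun (m 0) (kan_ickan m \<psi> L P) x - kan_fun m \<psi> L x 1\<bar> \<le> \<epsilon>"
      if "\<And>j. j \<in> {1..m 0} \<Longrightarrow> x j \<in> {0..1}" for x
      using compose_layers_kan_ickan_error[of P x L L 1] that P by (simp add: ickan_fun_def)
  qed
qed

end


section \<open>Maxima of affine functions\<close>

primrec prefix_max :: "(nat \<Rightarrow> real) \<Rightarrow> nat \<Rightarrow> real" where
  "prefix_max u 0 = u 0"
| "prefix_max u (Suc l) = max (prefix_max u l) (u (Suc l))"

lemma prefix_max_ge: "i \<le> l \<Longrightarrow> u i \<le> prefix_max u l"
  by (induction l) (auto simp: le_Suc_eq)

lemma prefix_max_attained: "\<exists>i\<le>l. prefix_max u l = u i"
  by (induction l) (force simp: max_def le_Suc_eq)+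

text \<open>For affine functions $A_0, \ldots, A_L$ put $M_l = \max(A_0, \ldots, A_l)$. Since
  $M_{l+1} - A_{l+2} = \max(M_l - A_{l+1}, 0) + (A_{l+1} - A_{l+2})$, the maximum is computed by
  nondecreasing convex blocks in the layers after the first: neuron 1 carries
  $M_l - A_{l+1}$ and neuron \<open>k > 1\<close> carries $A_{k-1} - A_k$, where $A_{L+1} = 0$.\<close>

definition max_net :: "(nat \<Rightarrow> nat \<Rightarrow> real) \<Rightarrow> (nat \<Rightarrow> real) \<Rightarrow> nat \<Rightarrow> nat \<Rightarrow> nat \<Rightarrow> real \<Rightarrow> real" where
  "max_net w c l k j t =
     (if l = 0 then (w (k - 1) j - w k j) * t + (if j = 1 then c (k - 1) - c k else 0)
      else if k = 1 \<and> j = 1 then max t 0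
      else if (k = 1 \<and> j = Suc l) \<or> (k > 1 \<and> j = k) then t else 0)"

text \<open>Each hidden layer holds the running maximum in neuron 1 and the differences in neurons 2
  to \<open>Suc L\<close>.\<close>

definition max_net_width :: "nat \<Rightarrow> nat \<Rightarrow> nat \<Rightarrow> nat" where
  "max_net_width n L l = (if l = 0 then n else if l \<le> L then Suc L else 1)"

text \<open>Slopes of either sign occur only in layer 0. The later blocks \<open>max t 0\<close>,
  \<open>t\<close> and \<open>0\<close> are convex, nondecreasing and 1-Lipschitz.\<close>

lemma convex_kan_max_net:
  "convex_kan (max_net w c) (\<lambda>l k j. if l = 0 then \<bar>w (k - 1) j - w k j\<bar> else 1)"
proof
  fix l k j
  have affine: "max_net w c 0 k j =
      (\<lambda>t. (w (k - 1) j - w k j) * t + (if j = 1 then c (k - 1) - c k else 0))"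
    by (auto simp: max_net_def)
  have later: "max_net w c l k j = (\<lambda>t. max t 0) \<or> max_net w c l k j = (\<lambda>t. t) \<or>
      max_net w c l k j = (\<lambda>t. 0)" if "l > 0"
    using that by (auto simp: max_net_def fun_eq_iff)
  have affine_convex: "convex_on UNIV (\<lambda>t::real. p * t + q)" for p q
    by (rule convex_on_realI[where f' = "\<lambda>t. p"]) (auto intro!: derivative_eq_intros)
  have relu_convex: "convex_on UNIV (\<lambda>t::real. max t 0)"
  proof (rule convex_on_linorderI)
    fix t x y :: real
    assume "0 < t" "t < 1"
    then show "max ((1 - t) *\<^sub>R x + t *\<^sub>R y) 0 \<le> (1 - t) * max x 0 + t * max y 0"
      by (auto intro!: add_mono mult_left_mono add_nonneg_nonneg mult_nonneg_nonneg)
  qed simp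
  show "convex_on UNIV (max_net w c l k j)"
    using later affine affine_convex relu_convex
    by (cases "l = 0") (auto simp: convex_on_ident convex_on_const)
  have "\<bar>w (k - 1) j - w k j\<bar>-lipschitz_on UNIV (max_net w c 0 k j)"
    unfolding affine by (rule lipschitz_onI)
      (auto simp: dist_real_def abs_mult[symmetric] right_diff_distrib)
  moreover have "1-lipschitz_on UNIV (max_net w c l k j)" if "l > 0"
    using later[OF that] by (auto intro!: lipschitz_onI simp: dist_real_def max_def)
  ultimately show "(if l = 0 then \<bar>w (k - 1) j - w k j\<bar> else 1)-lipschitz_on UNIV (max_net w c l k j)"
    by auto
  show "mono (max_net w c 0 k j) \<or> antimono (max_net w c 0 k j)"
    unfolding affine mono_def antimono_def
    by (cases "w (k - 1) j - w k j \<ge> 0") (auto intro: mult_left_mono mult_left_mono_neg)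
  show "mono (max_net w c l k j)" if "l > 0"
    using later[OF that] by (auto intro!: monoI)
qed

lemma kan_fun_max_net:
  fixes w c x n L
  defines "A \<equiv> \<lambda>i. (\<Sum>j=1..n. w i j * x j) + c i"
  assumes "1 \<le> n"
  shows "l \<le> L \<Longrightarrow> kan_fun (max_net_width n L) (max_net w c) l x 1
      = prefix_max A l - A (Suc l)" (is "_ \<Longrightarrow> ?v l = _")
    and "l < L \<Longrightarrow> k \<in> {2..Suc L} \<Longrightarrow>
      kan_fun (max_net_width n L) (max_net w c) l x k = A (k - 1) - A k"
proof -
  \<comment> \<open>The constants are attached to input \<open>j = 1\<close> alone, so that the sum
    over inputs counts them once.\<close>
  have zero: "kan_fun (max_net_width n L) (max_net w c) 0 x k = A (k - 1) - A k" for k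
    using \<open>1 \<le> n\<close> by (simp add: max_net_def max_net_width_def A_def sum.distrib
        left_diff_distrib sum_subtractf)
  show pass: "kan_fun (max_net_width n L) (max_net w c) l x k = A (k - 1) - A k"
    if "l < L" "k \<in> {2..Suc L}" for l k
    using that
  proof (induction l)
    case (Suc l)
    then have "kan_fun (max_net_width n L) (max_net w c) (Suc l) x k =
        (\<Sum>j=1..Suc L. if j = k then kan_fun (max_net_width n L) (max_net w c) l x k else 0)"
      by (auto simp: max_net_def max_net_width_def intro!: sum.cong)
    then show ?case
      using Suc by simp
  qed (rule zero)
  show "?v l = prefix_max A l - A (Suc l)" if "l \<le> L"
    using that
  proof (induction l)
    case (Suc l)
    define y where "y = kan_fun (max_net_width n L) (max_net w c) l x"
    have "?v (Suc l) = (\<Sum>j=1..Suc L. max_net w c (Suc l) 1 j (y j))"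
    proof -
      have "max_net_width n L (Suc l) = Suc L"
        using Suc.prems by (simp add: max_net_width_def)
      then show ?thesis
        unfolding y_def by (simp only: kan_fun.simps)
    qed
    \<comment> \<open>In layer \<open>Suc l\<close> neuron 1 reads neuron 1 and neuron
      \<open>l + 2\<close>, which exists because \<open>Suc l \<le> L\<close>.\<close>
    also have "\<dots> = (\<Sum>j=1..Suc L. (if j = 1 then max (y 1) 0 else 0) +
        (if j = l + 2 then y (l + 2) else 0))"
      by (intro sum.cong) (auto simp: max_net_def)
    also have "\<dots> = max (y 1) 0 + y (l + 2)"
      using Suc.prems unfolding sum.distrib by (simp del: sum.cl_ivl_Suc)
    finally show ?case
      using Suc pass[of l "l + 2"] by (simp add: y_def max_def)
  qed (use zero[of 1] in simp)
qed

section \<open>Density of the networks in the Lipschitz convex functions\<close>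

theorem theorem2p2:
  fixes f :: "real ^ 'n::finite \<Rightarrow> real" and e :: "nat \<Rightarrow> 'n" and \<epsilon> :: real
  assumes "bij_betw e {1..CARD('n)} UNIV"
    and "\<exists>C. C-lipschitz_on (cbox 0 1) f"
    and "convex_on (cbox 0 1) f"
    and "\<epsilon> > 0"
  shows "\<exists>K\<in>ickan_unif e. (SUP x\<in>cbox 0 1. ereal \<bar>f x - K x\<bar>) < ereal \<epsilon>"
proof -
  have cont: "continuous_on (cbox 0 1) f"
    using assms(2) lipschitz_on_continuous_on by blast
  \<comment> \<open>One quarter is spent on the affine maximum and one on interpolation; the total
    \<open>\<epsilon> / 2\<close> keeps the final inequality strict after the supremum.\<close>
  have \<epsilon>4: "\<epsilon> / 4 > 0"
    using assms(4) by simp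
  obtain T where T: "finite T"
    and minorant: "\<And>a b x. (a, b) \<in> T \<Longrightarrow> x \<in> cbox 0 1 \<Longrightarrow> a \<bullet> x + b \<le> f x"
    and approx: "\<And>x. x \<in> cbox 0 1 \<Longrightarrow> \<exists>(a, b)\<in>T. f x - \<epsilon> / 4 < a \<bullet> x + b"
    using convex_on_approx_finite_affine[OF compact_cbox assms(3) cont \<epsilon>4] by blast
  have "(0 :: real ^ 'n) \<in> cbox 0 1"
    by (simp add: mem_box_cart)
  then have "T \<noteq> {}"
    using approx by blast
  define L where "L = card T"
  have "1 \<le> L"
    using T \<open>T \<noteq> {}\<close> by (simp add: L_def Suc_le_eq card_gt_0_iff)
  obtain h where h: "bij_betw h {0..<L} T"
    using ex_bij_betw_nat_finite[OF T] unfolding L_def by blast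
  \<comment> \<open>The network takes the \<open>L + 1\<close> functions with indices 0 to
    \<open>L\<close>, while \<open>T\<close> has \<open>L\<close> elements; \<open>g L\<close>
    repeats \<open>g 0\<close>, which leaves the maximum unchanged.\<close>
  define g where "g i = h (i mod L)" for i
  have g_in: "g i \<in> T" for i
    using bij_betwE[OF h] \<open>1 \<le> L\<close> by (simp add: g_def)
  have g_surj: "\<exists>i\<le>L. g i = p" if "p \<in> T" for p
  proof -
    have "p \<in> h ` {0..<L}"
      using that bij_betw_imp_surj_on[OF h] by simp
    then obtain i where "i < L" "p = h i"
      by auto
    then show ?thesis
      by (intro exI[of _ i]) (simp add: g_def)
  qed
  \<comment> \<open>Zero data at index \<open>Suc L\<close> make the last affine function vanish, so
    that the output is the maximum itself.\<close>
  define w where "w i j = (if i \<le> L then fst (g i) $ e j else 0)" for i j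
  define c where "c i = (if i \<le> L then snd (g i) else 0)" for i
  define m where "m = max_net_width CARD('n) L"
  have [simp]: "m 0 = CARD('n)"
    by (simp add: m_def max_net_width_def)
  have widths: "l < L \<Longrightarrow> 1 \<le> m (Suc l)" "m (Suc L) = 1" for l
    by (simp_all add: m_def max_net_width_def)
  interpret convex_kan m "max_net w c" "\<lambda>l k j. if l = 0 then \<bar>w (k - 1) j - w k j\<bar> else 1"
    by (rule convex_kan_max_net)
  obtain N where wf: "wf_ickan N" and N: "\<And>x. (\<And>j. j \<in> {1..m 0} \<Longrightarrow> x j \<in> {0..1}) \<Longrightarrow>
      \<bar>ickan_fun (m 0) N x - kan_fun m (max_net w c) L x 1\<bar> \<le> \<epsilon> / 4"
    using kan_fun_approx[OF \<open>1 \<le> L\<close> widths \<epsilon>4] by blast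
  have close: "\<bar>f x - ickan_fun CARD('n) N (\<lambda>j. x $ e j)\<bar> \<le> \<epsilon> / 2" if x: "x \<in> cbox 0 1" for x
  proof -
    define A where "A i = (\<Sum>j=1..CARD('n). w i j * x $ e j) + c i" for i
    \<comment> \<open>Reindexing along the bijection \<open>e\<close> turns the sum over input
      numbers into the inner product.\<close>
    have A: "A i = fst (g i) \<bullet> x + snd (g i)" if "i \<le> L" for i
      using that sum.reindex_bij_betw[OF assms(1), of "\<lambda>i'. fst (g i) $ i' * x $ i'"]
      by (simp add: A_def w_def c_def inner_vec_def)
    have "kan_fun m (max_net w c) L (\<lambda>j. x $ e j) 1 = prefix_max A L - A (Suc L)"
      unfolding m_def A_def by (rule kan_fun_max_net) simp_all
    moreover have "A (Suc L) = 0"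
      by (simp add: A_def w_def c_def)
    moreover have "prefix_max A L \<le> f x"
    proof -
      obtain i where "i \<le> L" "prefix_max A L = A i"
        using prefix_max_attained by blast
      then show ?thesis
        using minorant[of "fst (g i)" "snd (g i)", OF _ x] g_in A by simp
    qed
    moreover have "f x - \<epsilon> / 4 \<le> prefix_max A L"
    proof -
      obtain p where "p \<in> T" "f x - \<epsilon> / 4 < fst p \<bullet> x + snd p"
        using approx[OF x] by auto
      moreover obtain i where "i \<le> L" "g i = p"
        using g_surj[OF \<open>p \<in> T\<close>] by blast
      ultimately show ?thesis
        using A[of i] prefix_max_ge[of i L A] by simp
    qed
    moreover have "\<bar>ickan_fun CARD('n) N (\<lambda>j. x $ e j) - kan_fun m (max_net w c) L (\<lambda>j. x $ e j) 1\<bar> \<le> \<epsilon> / 4"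
      using N[of "\<lambda>j. x $ e j"] x by (simp add: mem_box_cart)
    ultimately show ?thesis
      by linarith
  qed
  let ?K = "restrict (\<lambda>x. ickan_fun CARD('n) N (\<lambda>j. x $ e j)) (cbox 0 1)"
  have "(SUP x\<in>cbox 0 1. ereal \<bar>f x - ?K x\<bar>) \<le> ereal (\<epsilon> / 2)"
    using close by (intro SUP_least) simp
  also have "\<dots> < ereal \<epsilon>"
    using assms(4) by simp
  finally show ?thesis
    using wf unfolding ickan_unif_def by blast
qed

end
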